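(* Let $n>2$ with $n=p^\alpha q^\beta$, where $p,q$ are primes and $\alpha,\beta$ are non-negative integers. Then the comaximal graph $\Gamma(\mathbb{Z}_n)$ is Laplacian integral, i.e. all eigenvalues of its Laplacian matrix are integers.
   Context: The comaximal graph $\Gamma(\mathbb{Z}_n)$ has vertex set $\mathbb{Z}_n=\{0,1,\dots,n-1\}$, distinct $x,y$ adjacent iff $\langle x\rangle+\langle y\rangle=\mathbb{Z}_n$. Its Laplacian matrix is $L=D-A$ ($D$ diagonal degree matrix, $A$ adjacency matrix). *)

theory Defs
  imports "HOL-Number_Theory.Residues" "Jordan_Normal_Form.Char_Poly" Complex_Main
begin

definition comaximal :: "('a, 'b) ring_scheme \<Rightarrow> 'a \<Rightarrow> 'a \<Rightarrow> bool" where
  "comaximal R x y \<longleftrightarrow>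
     x \<in> carrier R \<and> y \<in> carrier R \<and> x \<noteq> y \<and>
     set_add R (genideal R {x}) (genideal R {y}) = carrier R"

text \<open>
  The comaximal graph of the integers modulo \<open>n\<close> has vertex set \<open>{0..<n}\<close>, the
  natural number \<open>i\<close> standing for the residue \<open>int i\<close>. The library's
  \<open>residue_ring\<close> has \<open>1\<close> as its unit element, so it is a ring only for modulus \<open>> 1\<close>.
\<close>

definition comaximal_adj :: "nat \<Rightarrow> nat \<Rightarrow> nat \<Rightarrow> bool" where
  "comaximal_adj n i j \<longleftrightarrow> comaximal (residue_ring (int n)) (int i) (int j)"

text \<open>
  A simple graph on the vertex set \<open>{0..<n}\<close> is given below by its adjacency
  relation \<open>E\<close>, assumed symmetric and irreflexive.
\<close>

definition vertex_degree :: "nat \<Rightarrow> (nat \<Rightarrow> nat \<Rightarrow> bool) \<Rightarrow> nat \<Rightarrow> nat" where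
  "vertex_degree n E i = card {j. j < n \<and> E i j}"

definition adjacency_mat :: "nat \<Rightarrow> (nat \<Rightarrow> nat \<Rightarrow> bool) \<Rightarrow> 'a :: comm_ring_1 mat" where
  "adjacency_mat n E = mat n n (\<lambda>(i, j). if E i j then 1 else 0)"

definition degree_mat :: "nat \<Rightarrow> (nat \<Rightarrow> nat \<Rightarrow> bool) \<Rightarrow> 'a :: comm_ring_1 mat" where
  "degree_mat n E = mat_diag n (\<lambda>i. of_nat (vertex_degree n E i))"

definition laplacian_mat :: "nat \<Rightarrow> (nat \<Rightarrow> nat \<Rightarrow> bool) \<Rightarrow> 'a :: comm_ring_1 mat" where
  "laplacian_mat n E = degree_mat n E - adjacency_mat n E"

text \<open>The eigenvalues are taken over the complex numbers, so none is left out.\<close>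

definition laplacian_integral :: "nat \<Rightarrow> (nat \<Rightarrow> nat \<Rightarrow> bool) \<Rightarrow> bool" where
  "laplacian_integral n E \<longleftrightarrow>
     (\<forall>k :: complex. eigenvalue (laplacian_mat n E) k \<longrightarrow> k \<in> \<int>)"

end

theory Submission
  imports Defs
begin

text \<open>
  Vertices \<open>i \<noteq> j\<close> are non-adjacent iff some prime divisor of \<open>n\<close> divides both, so with at most two
  prime divisors adjacency is governed by two predicates \<open>P\<close> and \<open>Q\<close>, which split the vertices into
  the classes \<open>U\<close> (neither), \<open>A\<close> (only \<open>P\<close>), \<open>B\<close> (only \<open>Q\<close>) and \<open>C\<close> (both), of sizes \<open>u, a, b, c\<close>.
  Let \<open>v\<close> be an eigenvector for a non-integer \<open>k\<close>. Since \<open>k \<noteq> 0\<close>, its entries sum to \<open>0\<close>. The rows of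
  \<open>U\<close> then read \<open>n v\<^sub>i = k v\<^sub>i\<close>, so \<open>v\<close> vanishes on \<open>U\<close>; the rows of \<open>C\<close> become \<open>u v\<^sub>i = k v\<^sub>i\<close>, so
  \<open>v\<close> vanishes on \<open>C\<close>. Hence the sums over \<open>A\<close> and \<open>B\<close> are opposite, the rows of \<open>A\<close> give
  \<open>u + a + b = k\<close> unless these sums are \<open>0\<close>, and then \<open>v\<close> vanishes on \<open>A\<close> and \<open>B\<close> as well.
\<close>

context residues
begin

text \<open>An ideal is the whole ring iff it contains the unit, and the principal ideals of
  \<open>x\<close> and \<open>y\<close> consist of their multiples.\<close>

lemma set_add_genideal_eq_carrier_iff:
  assumes "x \<in> carrier R" "y \<in> carrier R"
  shows "set_add R (genideal R {x}) (genideal R {y}) = carrier R \<longleftrightarrow>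
    (\<exists>a \<in> carrier R. \<exists>b \<in> carrier R. (a * x + b * y) mod m = 1)"
    (is "?I = _ \<longleftrightarrow> ?rhs")
proof -
  have I: "ideal ?I R"
    using assms by (intro add_ideals genideal_ideal) auto
  have "?I = carrier R \<longleftrightarrow> \<one> \<in> ?I"
    using ideal.one_imp_carrier[OF I] one_closed by blast
  also have "\<dots> \<longleftrightarrow> (\<exists>a \<in> carrier R. \<exists>b \<in> carrier R. \<one> = (a \<otimes> x) \<oplus> (b \<otimes> y))"
    using assms unfolding set_add_def'
    by (auto simp: cgenideal_eq_genideal[symmetric] cgenideal_def)
  also have "\<dots> \<longleftrightarrow> ?rhs"
    by (auto simp: res_add_eq res_mult_eq res_one_eq mod_simps)
  finally show ?thesis .
qed

lemma comaximal_iff_coprime: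
  assumes "x \<in> carrier R" "y \<in> carrier R"
  shows "comaximal R x y \<longleftrightarrow> x \<noteq> y \<and> coprime (gcd x y) m"
proof -
  have "coprime (gcd x y) m" if "(a * x + b * y) mod m = 1" for a b
  proof (rule coprimeI)
    fix d assume "d dvd gcd x y" "d dvd m"
    then have "d dvd (a * x + b * y) mod m"
      by (intro dvd_mod) auto
    with that show "d dvd 1" by simp
  qed
  moreover have "\<exists>a \<in> carrier R. \<exists>b \<in> carrier R. (a * x + b * y) mod m = 1"
    if cop: "coprime (gcd x y) m"
  proof -
    obtain s t where st: "s * gcd x y + t * m = 1"
      using bezout_int[of "gcd x y" m] cop unfolding coprime_iff_gcd_eq_1 by auto
    obtain a b where ab: "a * x + b * y = gcd x y"
      using bezout_int by blast
    \<comment> \<open>Scaling the Bezout representation of \<open>gcd x y\<close> by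
      \<open>s\<close> gives 1 modulo \<open>m\<close>; reducing the coefficients modulo
      \<open>m\<close> puts them into the carrier.\<close>
    have "((s * a) mod m * x + (s * b) mod m * y) mod m = (s * (a * x + b * y)) mod m"
      unfolding distrib_left mult.assoc[symmetric] by (intro mod_add_cong mod_mult_left_eq)
    also have "\<dots> = (s * gcd x y + t * m) mod m"
      by (simp add: ab)
    also have "\<dots> = 1"
      using m_gt_one by (simp only: st mod_pos_pos_trivial)
    finally show ?thesis
      using mod_in_carrier by blast
  qed
  ultimately show ?thesis
    using assms set_add_genideal_eq_carrier_iff[OF assms] unfolding comaximal_def by blast
qed

end

lemma comaximal_adj_iff:
  assumes "n > 1" "i < n" "j < n"
  shows "comaximal_adj n i j \<longleftrightarrow> i \<noteq> j \<and> (\<forall>r. prime r \<and> r dvd n \<longrightarrow> \<not> (r dvd i \<and> r dvd j))"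
proof -
  interpret residues "int n" "residue_ring (int n)"
    using assms by unfold_locales auto
  have "comaximal_adj n i j \<longleftrightarrow> i \<noteq> j \<and> coprime (gcd i j) n"
    unfolding comaximal_adj_def
    by (subst comaximal_iff_coprime) (use assms in \<open>auto simp: res_carrier_eq\<close>)
  also have "coprime (gcd i j) n \<longleftrightarrow> (\<forall>r. prime r \<and> r dvd n \<longrightarrow> \<not> (r dvd i \<and> r dvd j))"
  proof (intro iffI allI impI notI)
    fix r assume "coprime (gcd i j) n" "prime r \<and> r dvd n" "r dvd i \<and> r dvd j"
    then have "is_unit r"
      by (intro coprime_common_divisor[of "gcd i j" n r]) auto
    with \<open>prime r \<and> r dvd n\<close> show False
      by simp
  next
    assume "\<forall>r. prime r \<and> r dvd n \<longrightarrow> \<not> (r dvd i \<and> r dvd j)"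
    then have "\<nexists>r. prime r \<and> r dvd gcd (gcd i j) n"
      by (simp only: gcd_greatest_iff) blast
    then have "gcd (gcd i j) n = 1"
      using prime_factor_nat by blast
    then show "coprime (gcd i j) n"
      by (simp only: coprime_iff_gcd_eq_1)
  qed
  finally show ?thesis .
qed

text \<open>Every prime divisor of \<open>n\<close> is \<open>p\<close> or \<open>q\<close>. The
  conjuncts \<open>p dvd n\<close> and \<open>q dvd n\<close> cover zero exponents: a prime that
  does not divide \<open>n\<close> must not block any edge.\<close>

lemma comaximal_adj_two_primes:
  fixes n p q :: nat
  assumes "n > 1" "prime p" "prime q" "n = p ^ \<alpha> * q ^ \<beta>" "i < n" "j < n"
  shows "comaximal_adj n i j \<longleftrightarrow>
    i \<noteq> j \<and> \<not> ((p dvd n \<and> p dvd i) \<and> (p dvd n \<and> p dvd j))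
      \<and> \<not> ((q dvd n \<and> q dvd i) \<and> (q dvd n \<and> q dvd j))"
proof -
  have "r = p \<or> r = q" if "prime r" "r dvd n" for r
    using that assms(2-4)
    by (metis prime_dvd_mult_iff prime_dvd_power primes_dvd_imp_eq)
  then show ?thesis
    using assms comaximal_adj_iff by blast
qed

text \<open>The summand vanishes at \<open>j = i\<close>, so \<open>E\<close> may be made reflexive under the sum.\<close>

lemma laplacian_mat_mult_vec_index:
  fixes v :: "'a :: comm_ring_1 vec"
  assumes "v \<in> carrier_vec n" "i < n"
  shows "(laplacian_mat n E *\<^sub>v v) $ i = (\<Sum>j | j < n \<and> E i j. v $ i - v $ j)"
proof -
  have "(laplacian_mat n E *\<^sub>v v) $ i =
      (\<Sum>j<n. (if i = j then of_nat (vertex_degree n E j) * v $ j else 0)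
              - (if E i j then v $ j else 0))"
    using assms unfolding laplacian_mat_def degree_mat_def adjacency_mat_def mat_diag_def
    by (auto simp: scalar_prod_def atLeast0LessThan algebra_simps intro!: sum.cong)
  also have "\<dots> = of_nat (vertex_degree n E i) * v $ i - (\<Sum>j<n. if E i j then v $ j else 0)"
    using assms(2) by (simp add: sum_subtractf)
  also have "(\<Sum>j<n. if E i j then v $ j else 0) = (\<Sum>j | j < n \<and> E i j. v $ j)"
    by (simp add: sum.inter_filter[symmetric])
  finally show ?thesis
    by (simp add: sum_subtractf vertex_degree_def)
qed

text \<open>With \<open>P\<close> and \<open>Q\<close> arbitrary, some classes may be empty, so
  prime powers and the case \<open>p = q\<close> are included.\<close>

lemma laplacian_integral_two_predicates:
  assumes E: "\<And>i j. i < n \<Longrightarrow> j < n \<Longrightarrow>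
    E i j \<longleftrightarrow> i \<noteq> j \<and> \<not> (P i \<and> P j) \<and> \<not> (Q i \<and> Q j)"
  shows "laplacian_integral n E"
  unfolding laplacian_integral_def
proof (intro allI impI, rule ccontr)
  fix k :: complex
  assume "eigenvalue (laplacian_mat n E) k" and k: "k \<notin> \<int>"
  then obtain v where v: "v \<in> carrier_vec n" "v \<noteq> 0\<^sub>v n"
    and Lv: "laplacian_mat n E *\<^sub>v v = k \<cdot>\<^sub>v v"
    unfolding eigenvalue_def eigenvector_def laplacian_mat_def adjacency_mat_def by auto
  \<comment> \<open>All coefficients on the left of the row equations below have this form, so they
    can be cancelled; \<open>m = 0\<close> gives \<open>k \<noteq> 0\<close>.\<close>
  have k_neq: "of_nat m - k \<noteq> 0" for m
    using k by (metis Ints_of_nat eq_iff_diff_eq_0)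
  define U where "U = {j. j < n \<and> \<not> P j \<and> \<not> Q j}"
  define A where "A = {j. j < n \<and> P j \<and> \<not> Q j}"
  define B where "B = {j. j < n \<and> \<not> P j \<and> Q j}"
  define C where "C = {j. j < n \<and> P j \<and> Q j}"
  define s where "s X = (\<Sum>j\<in>X. v $ j)" for X
  note defs = U_def A_def B_def C_def
  have fin: "finite U" "finite A" "finite B" "finite C"
    by (auto simp: defs)
  \<comment> \<open>\<open>N\<close> may contain \<open>i\<close> itself, with summand 0; this makes
    \<open>N\<close> a union of whole classes even for \<open>i\<close> in \<open>U\<close>.\<close>
  have row: "(\<Sum>j\<in>N. v $ i - v $ j) = k * v $ i"
    if "i < n" "N = {j. j < n \<and> \<not> (P i \<and> P j) \<and> \<not> (Q i \<and> Q j)}" for i N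
  proof -
    have "(\<Sum>j\<in>N. v $ i - v $ j) = (\<Sum>j | j < n \<and> E i j. v $ i - v $ j)"
      using that by (intro sum.mono_neutral_right) (auto simp: E)
    also have "\<dots> = k * v $ i"
      using laplacian_mat_mult_vec_index[OF v(1) that(1), of E] v(1) that(1) Lv by simp
    finally show ?thesis .
  qed
  have rowU: "(of_nat (card U + card A + card B + card C) - k) * v $ i = s U + s A + s B + s C"
    if "i \<in> U" for i
  proof -
    have "(\<Sum>j\<in>U \<union> A \<union> B \<union> C. v $ i - v $ j) = k * v $ i"
      by (rule row) (use that in \<open>auto simp: defs\<close>)
    moreover have "(\<Sum>j\<in>U \<union> A \<union> B \<union> C. v $ i - v $ j) =
        (\<Sum>j\<in>U. v $ i - v $ j) + (\<Sum>j\<in>A. v $ i - v $ j)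
        + (\<Sum>j\<in>B. v $ i - v $ j) + (\<Sum>j\<in>C. v $ i - v $ j)"
      by (subst sum.union_disjoint; (use fin in \<open>auto simp: defs\<close>)?)+
    ultimately show ?thesis
      by (simp add: sum_subtractf s_def algebra_simps)
  qed
  have rowA: "(of_nat (card U + card B) - k) * v $ i = s U + s B" if "i \<in> A" for i
  proof -
    have "(\<Sum>j\<in>U \<union> B. v $ i - v $ j) = k * v $ i"
      by (rule row) (use that in \<open>auto simp: defs\<close>)
    moreover have "(\<Sum>j\<in>U \<union> B. v $ i - v $ j) =
        (\<Sum>j\<in>U. v $ i - v $ j) + (\<Sum>j\<in>B. v $ i - v $ j)"
      by (rule sum.union_disjoint) (use fin in \<open>auto simp: defs\<close>)
    ultimately show ?thesis
      by (simp add: sum_subtractf s_def algebra_simps)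
  qed
  have rowB: "(of_nat (card U + card A) - k) * v $ i = s U + s A" if "i \<in> B" for i
  proof -
    have "(\<Sum>j\<in>U \<union> A. v $ i - v $ j) = k * v $ i"
      by (rule row) (use that in \<open>auto simp: defs\<close>)
    moreover have "(\<Sum>j\<in>U \<union> A. v $ i - v $ j) =
        (\<Sum>j\<in>U. v $ i - v $ j) + (\<Sum>j\<in>A. v $ i - v $ j)"
      by (rule sum.union_disjoint) (use fin in \<open>auto simp: defs\<close>)
    ultimately show ?thesis
      by (simp add: sum_subtractf s_def algebra_simps)
  qed
  have rowC: "(of_nat (card U) - k) * v $ i = s U" if "i \<in> C" for i
  proof -
    have "(\<Sum>j\<in>U. v $ i - v $ j) = k * v $ i"
      by (rule row) (use that in \<open>auto simp: defs\<close>)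
    then show ?thesis
      by (simp add: sum_subtractf s_def algebra_simps)
  qed
  \<comment> \<open>The right-hand side of a row equation is constant on each class, so summing over
    the class leaves relations between the four class sums only.\<close>
  have sum_rows: "d * s X = of_nat (card X) * t" if "\<And>i. i \<in> X \<Longrightarrow> d * v $ i = t" for X d t
    using that by (simp add: s_def sum_distrib_left)
  have sumU: "(of_nat (card U + card A + card B + card C) - k) * s U =
      of_nat (card U) * (s U + s A + s B + s C)"
    by (rule sum_rows) (rule rowU)
  have sumA: "(of_nat (card U + card B) - k) * s A = of_nat (card A) * (s U + s B)"
    by (rule sum_rows) (rule rowA)
  have sumB: "(of_nat (card U + card A) - k) * s B = of_nat (card B) * (s U + s A)"
    by (rule sum_rows) (rule rowB)
  have sumC: "(of_nat (card U) - k) * s C = of_nat (card C) * s U"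
    by (rule sum_rows) (rule rowC)
  have "k * (s U + s A + s B + s C) = 0"
  proof -
    \<comment> \<open>The columns of the Laplacian sum to 0: adding the four class relations, the
      contributions of edges between two classes cancel, and so do those within
      \<open>U\<close>.\<close>
    have "k * (s U + s A + s B + s C) =
        (of_nat (card U) * (s U + s A + s B + s C)
          - (of_nat (card U + card A + card B + card C) - k) * s U)
        + (of_nat (card A) * (s U + s B) - (of_nat (card U + card B) - k) * s A)
        + (of_nat (card B) * (s U + s A) - (of_nat (card U + card A) - k) * s B)
        + (of_nat (card C) * s U - (of_nat (card U) - k) * s C)"
      by (simp add: algebra_simps)
    also have "\<dots> = 0"
      by (simp only: sumU sumA sumB sumC diff_self add_0)
    finally show ?thesis .
  qed
  then have total: "s U + s A + s B + s C = 0"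
    using k_neq[of 0] by auto
  have vU: "v $ i = 0" if "i \<in> U" for i
    using rowU[OF that] total k_neq by (metis mult_eq_0_iff)
  then have sU: "s U = 0"
    by (simp add: s_def)
  have vC: "v $ i = 0" if "i \<in> C" for i
    using rowC[OF that] sU k_neq by (metis mult_eq_0_iff)
  then have "s C = 0"
    by (simp add: s_def)
  then have sAB: "s B = - s A"
    using total sU by (simp add: add_eq_0_iff)
  \<comment> \<open>Substituting \<open>s B = - s A\<close> into \<open>sumA\<close> moves the term
    \<open>card A\<close> into the coefficient on the left.\<close>
  have "(of_nat (card U + card A + card B) - k) * s A = 0"
    using sumA sAB sU by (simp add: algebra_simps)
  then have "s A = 0"
    using k_neq by (metis mult_eq_0_iff)
  then have vA: "v $ i = 0" if "i \<in> A" for i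
    using rowA[OF that] sU sAB k_neq by (metis add_0 minus_zero mult_eq_0_iff)
  have vB: "v $ i = 0" if "i \<in> B" for i
    using rowB[OF that] sU \<open>s A = 0\<close> k_neq by (metis add_0 mult_eq_0_iff)
  have "v $ i = 0" if "i < n" for i
    using that vU vA vB vC by (auto simp: defs)
  then have "v = 0\<^sub>v n"
    using v(1) by (intro eq_vecI) auto
  with v(2) show False by contradiction
qed

theorem theorem3p13:
  fixes n p q \<alpha> \<beta> :: nat
  assumes "n > 2" and "prime p" and "prime q" and "n = p ^ \<alpha> * q ^ \<beta>"
  shows "laplacian_integral n (comaximal_adj n)"
proof (rule laplacian_integral_two_predicates)
  show "comaximal_adj n i j \<longleftrightarrow>
      i \<noteq> j \<and> \<not> ((p dvd n \<and> p dvd i) \<and> (p dvd n \<and> p dvd j))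
        \<and> \<not> ((q dvd n \<and> q dvd i) \<and> (q dvd n \<and> q dvd j))" if "i < n" "j < n" for i j
    using comaximal_adj_two_primes assms that by simp
qed

end
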